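(* Let $k$ be an algebraically closed field of characteristic $0$ and let $\Theta\in\bigcup_{m\in\mathbb N}\Sigma_m$. Then the set $\{\Xi\mid\Theta\le_p\Xi\}$ of polynomial classes $\Xi$ is finite.
   Context: For $A,B\subseteq k$, $A\le_p B$ means that there is a polynomial function $P:k\to k$ with $A=P^{-1}(B)$; $A\equiv_p B$ means $A\le_p B$ and $B\le_p A$; $[A]$ is the $\equiv_p$-class of $A$ and is called a polynomial class. The symbol $\le_p$ also denotes the induced partial order on polynomial classes: $[A]\le_p[B]$ iff $A\le_p B$. $\mathbb N$ is the set of natural numbers, including $0$. For $m\in\mathbb N$, $\Sigma_m$ is the set of classes $[A]$ of subsets $A$ of $k$ with exactly $m$ elements.
   Formalization: The case m = 0 (the class of the empty set) is excluded: constant polynomials give ∅ ≤_p B for every B ≠ k, so infinitely many classes lie above [∅] and the claim fails there. *)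

theory Defs
  imports "HOL-Computational_Algebra.Polynomial"
begin

definition poly_le :: "'a::comm_semiring_0 set \<Rightarrow> 'a set \<Rightarrow> bool"  (infix \<open>\<le>\<^sub>p\<close> 50)
  where "A \<le>\<^sub>p B \<longleftrightarrow> (\<exists>P. A = poly P -` B)"

definition poly_equiv :: "('a::comm_semiring_0 set \<times> 'a set) set"
  where "poly_equiv = {(A, B). A \<le>\<^sub>p B \<and> B \<le>\<^sub>p A}"

definition poly_class :: "'a::comm_semiring_0 set \<Rightarrow> 'a set set"
  where "poly_class A = poly_equiv `` {A}"

definition poly_classes :: "'a::comm_semiring_0 set set set"
  where "poly_classes = UNIV // poly_equiv"

definition class_le :: "'a::comm_semiring_0 set set \<Rightarrow> 'a set set \<Rightarrow> bool"  (infix \<open>\<sqsubseteq>\<^sub>p\<close> 50)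
  where "\<Theta> \<sqsubseteq>\<^sub>p \<Xi> \<longleftrightarrow> (\<exists>A B. \<Theta> = poly_class A \<and> \<Xi> = poly_class B \<and> A \<le>\<^sub>p B)"

text \<open>Finiteness is explicit because \<^const>\<open>card\<close> is 0 on infinite sets.\<close>

definition Sigma_class :: "nat \<Rightarrow> 'a::comm_semiring_0 set set set"
  where "Sigma_class m = {poly_class A | A. finite A \<and> card A = m}"

lemma poly_le_refl: "(A :: 'a::comm_semiring_1 set) \<le>\<^sub>p A"
  unfolding poly_le_def by (rule exI[of _ "[:0, 1:]"]) auto

lemma poly_le_trans:
  assumes "(A :: 'a::comm_semiring_0 set) \<le>\<^sub>p B" "B \<le>\<^sub>p C"
  shows "A \<le>\<^sub>p C"
proof -
  from assms obtain P Q where "A = poly P -` B" "B = poly Q -` C"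
    unfolding poly_le_def by blast
  then have "A = poly (pcompose Q P) -` C"
    by (auto simp: poly_pcompose)
  then show ?thesis
    unfolding poly_le_def by blast
qed

lemma equiv_poly_equiv: "equiv UNIV (poly_equiv :: ('a::comm_semiring_1 set \<times> 'a set) set)"
proof (rule equivI)
  show "refl (poly_equiv :: ('a set \<times> 'a set) set)"
    by (rule refl_onI) (auto simp: poly_equiv_def poly_le_refl)
  show "sym (poly_equiv :: ('a set \<times> 'a set) set)"
    by (rule symI) (auto simp: poly_equiv_def)
  show "trans (poly_equiv :: ('a set \<times> 'a set) set)"
    by (rule transI) (auto simp: poly_equiv_def intro: poly_le_trans)
qed simp

lemma poly_class_eq_iff:
  "poly_class A = poly_class B \<longleftrightarrow> A \<le>\<^sub>p B \<and> B \<le>\<^sub>p (A :: 'a::comm_semiring_1 set)"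
  unfolding poly_class_def
  using eq_equiv_class_iff[OF equiv_poly_equiv, of A B] by (simp add: poly_equiv_def)

lemma poly_class_in_poly_classes: "poly_class A \<in> poly_classes"
  unfolding poly_class_def poly_classes_def by (rule quotientI) simp

lemma class_le_poly_class:
  "poly_class A \<sqsubseteq>\<^sub>p poly_class B \<longleftrightarrow> A \<le>\<^sub>p (B :: 'a::comm_semiring_1 set)"
  unfolding class_le_def poly_class_eq_iff by (blast intro: poly_le_trans poly_le_refl)

text \<open>
  Constant polynomials put the class of the empty set below every class except that of \<^const>\<open>UNIV\<close>,
  and there are infinitely many of those. So the class of the empty set, which is the only
  element of the zeroth \<^const>\<open>Sigma_class\<close>, is a genuine exception to finiteness of upper cones.
\<close>

lemma empty_poly_le_iff: "{} \<le>\<^sub>p (B :: 'a::comm_semiring_1 set) \<longleftrightarrow> B \<noteq> UNIV"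
proof
  assume "B \<noteq> UNIV"
  then obtain c where "c \<notin> B" by blast
  then have "{} = poly [:c:] -` B" by auto
  then show "{} \<le>\<^sub>p B" unfolding poly_le_def by blast
qed (auto simp: poly_le_def)

lemma poly_le_finite_card:
  fixes A B :: "'a::{alg_closed_field,field_char_0} set"
  assumes "A \<le>\<^sub>p B" "finite A" "A \<noteq> {}"
  shows "card B \<le> card A"
proof -
  from assms(1) obtain P where P: "A = poly P -` B" unfolding poly_le_def by blast
  have "degree P > 0"
  proof (rule ccontr)
    assume "\<not> degree P > 0"
    then obtain c where "P = [:c:]" using degree_eq_zeroE by blast
    then have "A = {} \<or> A = UNIV" using P by auto
    then show False using assms infinite_UNIV_char_0[where 'a='a] by auto
  qed
  have "B \<subseteq> poly P ` A"
  proof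
    fix b assume "b \<in> B"
    have "degree (P - [:b:]) = degree P"
      using \<open>degree P > 0\<close> by (metis degree_add_eq_left degree_minus degree_pCons_0 diff_conv_add_uminus)
    then have "degree (P - [:b:]) > 0"
      using \<open>degree P > 0\<close> by simp
    then obtain x where "poly (P - [:b:]) x = 0"
      using alg_closed_imp_poly_has_root by blast
    then have "poly P x = b" by simp
    then show "b \<in> poly P ` A" using P \<open>b \<in> B\<close> by blast
  qed
  then show ?thesis using surj_card_le[OF assms(2)] by blast
qed

lemma infinite_above_empty:
  "infinite {\<Xi> \<in> poly_classes. poly_class ({} :: 'a::{alg_closed_field,field_char_0} set) \<sqsubseteq>\<^sub>p \<Xi>}"
proof -
  have "\<exists>A :: 'a set. finite A \<and> card A = Suc n" for n
    using infinite_arbitrarily_large[OF infinite_UNIV_char_0] by blast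
  then obtain S :: "nat \<Rightarrow> 'a set" where S: "\<And>n. finite (S n)" "\<And>n. card (S n) = Suc n"
    by metis
  have ne: "S n \<noteq> {}" "S n \<noteq> UNIV" for n
    using S[of n] infinite_UNIV_char_0[where 'a='a] by auto
  have "inj (\<lambda>n. poly_class (S n))"
  proof (rule injI)
    fix m n assume "poly_class (S m) = poly_class (S n)"
    then have "S m \<le>\<^sub>p S n" "S n \<le>\<^sub>p S m" by (auto simp: poly_class_eq_iff)
    then have "card (S m) = card (S n)"
      using poly_le_finite_card S(1) ne(1) by (meson le_antisym)
    then show "m = n" by (simp add: S(2))
  qed
  then have "infinite (range (\<lambda>n. poly_class (S n)))" by (rule range_inj_infinite)
  moreover have "range (\<lambda>n. poly_class (S n)) \<subseteq> {\<Xi> \<in> poly_classes. poly_class {} \<sqsubseteq>\<^sub>p \<Xi>}"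
    by (auto simp: class_le_poly_class empty_poly_le_iff ne poly_class_in_poly_classes)
  ultimately show ?thesis using infinite_super by blast
qed

lemma Sigma_class_0: "Sigma_class 0 = {poly_class {}}"
  by (auto simp: Sigma_class_def)

end

theory Submission
  imports Defs
begin

text \<open>
  Let \<open>A\<close> be finite and nonempty with \<open>A = P\<^sup>-\<^sup>1(B)\<close>. Then \<open>P\<close> is not constant, hence surjective, and
  \<open>B = P(A)\<close> is determined by \<open>A\<close> and \<open>P\<close>. All singletons are affinely equivalent, so suppose that
  \<open>B\<close> has at least two points. Two facts leave only finitely many classes for \<open>B\<close>.

  First, the degree \<open>n\<close> of \<open>P\<close> is bounded. Counted with multiplicity, each of the fibres over \<open>B\<close>
  has \<open>n\<close> points, and the total excess over the number \<open>|A|\<close> of distinct points is at most the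
  number \<open>n - 1\<close> of zeros of \<open>P'\<close>. So \<open>n |B| \<le> n - 1 + |A|\<close>, which for \<open>|B| \<ge> 2\<close> gives \<open>n < |A|\<close>
  (lemma \<open>degree_mult_card_le_card_vimage\<close>).

  Second, replacing \<open>B\<close> by an affine image does not change its class, and it can be chosen such that
  \<open>0 \<in> B\<close> and \<open>P\<close> is monic. Now all roots of \<open>P\<close> lie in \<open>A\<close>, and a monic polynomial is determined
  by the multiset of its roots. Only finitely many multisets of fewer than \<open>|A|\<close> elements can be
  formed from \<open>A\<close>, so there are finitely many such \<open>P\<close>, and finitely many \<open>B = P(A)\<close>.
\<close>

lemma degree_diff_const: "degree (P - [:b :: 'a::ab_group_add:]) = degree P"
proof (cases "degree P = 0")
  case True
  then obtain a where "P = [:a:]" by (rule degree_eq_zeroE)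
  then show ?thesis by simp
next
  case False
  then show ?thesis using degree_add_eq_left[of "- [:b:]" P] by (simp del: minus_pCons)
qed

lemma surj_poly:
  fixes P :: "'a::alg_closed_field poly"
  assumes "degree P > 0"
  shows "surj (poly P)"
  unfolding surj_def
proof
  fix b
  obtain x where "poly (P - [:b:]) x = 0"
    using alg_closed_imp_poly_has_root[of "P - [:b:]"] assms by (auto simp: degree_diff_const)
  then show "\<exists>x. b = poly P x" by (intro exI[of _ x]) simp
qed

lemma poly_le_finiteE:
  fixes A B :: "'a::{alg_closed_field,field_char_0} set"
  assumes "A \<le>\<^sub>p B" "finite A" "A \<noteq> {}"
  obtains P where "degree P > 0" "A = poly P -` B" "B = poly P ` A"
proof -
  from assms(1) obtain P where P: "A = poly P -` B" unfolding poly_le_def by blast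
  have deg: "degree P > 0"
  proof (rule ccontr)
    assume "\<not> degree P > 0"
    then obtain c where "P = [:c:]" using degree_eq_zeroE by blast
    then have "A = {} \<or> A = UNIV" using P by auto
    then show False using assms infinite_UNIV_char_0[where 'a='a] by auto
  qed
  show thesis
    using that[OF deg P] P surj_image_vimage_eq[OF surj_poly[OF deg], of B] by simp
qed

lemma size_proots:
  fixes P :: "'a::alg_closed_field poly"
  shows "size (proots P) = degree P"
proof (cases "P = 0")
  case False
  then obtain M where M: "size M = degree P" "P = smult (lead_coeff P) (\<Prod>x\<in>#M. [:-x, 1:])"
    using alg_closed_imp_factorization by blast
  have "proots P = proots (\<Prod>x\<in>#M. [:-x, 1:])"
    using False by (subst M(2)) simp
  also have "\<dots> = M"
  proof (induction M)
    case (add x M)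
    have "proots ([:-x, 1:] * (\<Prod>y\<in>#M. [:-y, 1:])) = proots [:-x, 1:] + proots (\<Prod>y\<in>#M. [:-y, 1:])"
      by (rule proots_mult) (auto simp: prod_mset_zero_iff)
    then show ?case using add.IH by (simp del: mult_pCons_left)
  qed simp
  finally show ?thesis using M(1) by simp
qed simp

text \<open>
  A point of multiplicity \<open>e\<close> in its fibre is a zero of \<open>P'\<close> of order exactly \<open>e - 1\<close>, because the
  characteristic is \<open>0\<close>. Hence the sum of all the fibres over \<open>S\<close>, as a multiset, is contained in
  the multiset of zeros of \<open>P'\<close> plus one copy of each point above \<open>S\<close>. Comparing sizes gives the
  inequality.
\<close>

lemma degree_mult_card_le_card_vimage:
  fixes P :: "'a::{alg_closed_field,field_char_0} poly"
  assumes "degree P > 0" "finite S" and fin: "finite (poly P -` S)"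
  shows "degree P * card S \<le> degree P - 1 + card (poly P -` S)"
proof -
  have nz: "P - [:b:] \<noteq> 0" for b
    using assms(1) degree_diff_const[of P b] by (metis degree_0 less_irrefl)
  have pd: "pderiv (P - [:b:]) = pderiv P" for b by (simp add: pderiv_diff)
  have nz': "pderiv P \<noteq> 0" using assms(1) by (simp add: pderiv_eq_0_iff)
  have "(\<Sum>b\<in>S. proots (P - [:b:])) \<subseteq># proots (pderiv P) + mset_set (poly P -` S)"
  proof (rule mset_subset_eqI)
    fix x
    have zero: "order x (P - [:b:]) = 0" if "b \<noteq> poly P x" for b
      using that by (intro order_0I) simp
    have "count (\<Sum>b\<in>S. proots (P - [:b:])) x = (\<Sum>b\<in>S. order x (P - [:b:]))"
      using nz by (simp add: count_sum)
    also have "\<dots> = (\<Sum>b\<in>S. if b = poly P x then order x (P - [:b:]) else 0)"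
      by (rule sum.cong) (auto simp: zero)
    also have "\<dots> = (if poly P x \<in> S then order x (P - [:poly P x:]) else 0)"
      using assms(2) by simp
    also have "\<dots> = (if poly P x \<in> S then Suc (order x (pderiv P)) else 0)"
      using order_pderiv[OF nz, of "poly P x" x] by (simp add: pd)
    also have "\<dots> \<le> count (proots (pderiv P) + mset_set (poly P -` S)) x"
      using nz' fin by simp
    finally show "count (\<Sum>b\<in>S. proots (P - [:b:])) x
      \<le> count (proots (pderiv P) + mset_set (poly P -` S)) x" .
  qed
  from size_mset_mono[OF this] show ?thesis
    by (simp add: size_multiset_sum size_proots degree_diff_const degree_pderiv mult.commute)
qed

lemma finite_monic_polys_roots_subset:
  fixes A :: "'a::alg_closed_field set"
  assumes "finite A"
  shows "finite {P. lead_coeff P = 1 \<and> degree P < n \<and> {x. poly P x = 0} \<subseteq> A}"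
proof (rule finite_subset)
  show "{P. lead_coeff P = 1 \<and> degree P < n \<and> {x. poly P x = 0} \<subseteq> A}
    \<subseteq> (\<lambda>M. \<Prod>x\<in>#M. [:-x, 1:]) ` (\<Union>i<n. multisets_of_size A i)"
  proof safe
    fix P :: "'a poly"
    assume P: "lead_coeff P = 1" "degree P < n" "{x. poly P x = 0} \<subseteq> A"
    then have "P \<noteq> 0" by auto
    then obtain M where M: "size M = degree P" "P = (\<Prod>x\<in>#M. [:-x, 1:])"
      using alg_closed_imp_factorization[of P] P(1) by auto
    have "poly P x = 0" if "x \<in># M" for x
      using that by (auto simp: M(2) poly_prod_mset prod_mset_zero_iff)
    then have "set_mset M \<subseteq> A" using P(3) by auto
    then show "P \<in> (\<lambda>M. \<Prod>x\<in>#M. [:-x, 1:]) ` (\<Union>i<n. multisets_of_size A i)"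
      using M P(2) by (auto simp: multisets_of_size_def)
  qed
  show "finite ((\<lambda>M. \<Prod>x\<in>#M. [:-x, 1:]) ` (\<Union>i<n. multisets_of_size A i))"
    using assms by auto
qed

lemma poly_class_affine_image:
  fixes B :: "'a::field set"
  assumes "c \<noteq> 0"
  shows "poly_class (poly [:a, c:] ` B) = poly_class B"
proof -
  have "B = poly [:a, c:] -` (poly [:a, c:] ` B)"
    using assms by auto
  moreover have "poly [:a, c:] ` B = poly [:- a / c, 1 / c:] -` B"
  proof safe
    fix y assume "poly [:- a / c, 1 / c:] y \<in> B"
    moreover have "y = poly [:a, c:] (poly [:- a / c, 1 / c:] y)"
      using assms by (simp add: field_simps)
    ultimately show "y \<in> poly [:a, c:] ` B" by blast
  qed (use assms in \<open>auto simp: field_simps\<close>)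
  ultimately show ?thesis
    unfolding poly_class_eq_iff poly_le_def by blast
qed

lemma poly_class_singleton: "poly_class {b :: 'a::field} = poly_class {0}"
  using poly_class_affine_image[of 1 "- b" "{b}"] by simp

text \<open>
  If \<open>P\<close> maps \<open>A\<close> onto \<open>B\<close> and \<open>b \<in> B\<close>, then the affine map \<open>y \<mapsto> (y - b) / c\<close>, with \<open>c\<close> the leading
  coefficient of \<open>P\<close>, turns \<open>P\<close> into a monic \<open>Q\<close> whose roots form the fibre over \<open>b\<close>, a subset of
  \<open>A\<close>.
\<close>

lemma poly_le_imp_monic_image:
  fixes A B :: "'a::{alg_closed_field,field_char_0} set"
  assumes "A \<le>\<^sub>p B" "finite A" "A \<noteq> {}" "card B \<ge> 2"
  obtains Q where "lead_coeff Q = 1" "degree Q < card A" "{x. poly Q x = 0} \<subseteq> A"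
    "poly_class B = poly_class (poly Q ` A)"
proof -
  obtain P where P: "degree P > 0" "A = poly P -` B" "B = poly P ` A"
    using poly_le_finiteE[OF assms(1-3)] by blast
  have "degree P * 2 \<le> degree P * card B" using assms(4) by simp
  also have "\<dots> \<le> degree P - 1 + card A"
    using degree_mult_card_le_card_vimage[of P B] P assms(2) by (metis finite_imageI)
  finally have less: "degree P < card A" using P(1) by linarith
  obtain b where b: "b \<in> B" using P(3) assms(3) by auto
  define c where "c = lead_coeff P"
  have c: "c \<noteq> 0" using P(1) by (auto simp: c_def)
  define Q where "Q = smult (1 / c) (P - [:b:])"
  have deg: "degree Q = degree P"
    using c by (simp add: Q_def degree_diff_const)
  show thesis
  proof (rule that)
    have "coeff [:b:] (degree P) = 0" using P(1) by (simp add: coeff_eq_0)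
    then show "lead_coeff Q = 1"
      unfolding deg using c by (simp add: Q_def c_def)
    show "degree Q < card A" using less deg by simp
    show "{x. poly Q x = 0} \<subseteq> A" using P(2) b c by (auto simp: Q_def)
    have "poly Q ` A = poly [:- b / c, 1 / c:] ` B"
      unfolding P(3) image_image by (simp add: Q_def diff_divide_distrib)
    then show "poly_class B = poly_class (poly Q ` A)"
      using poly_class_affine_image[of "1 / c" "- b / c" B] c by simp
  qed
qed

theorem proposition41:
  fixes \<Theta> :: "'k::{alg_closed_field,field_char_0} set set"
  assumes "\<Theta> \<in> (\<Union>m. Sigma_class m)"
    and "\<Theta> \<noteq> poly_class {}"
  shows "finite {\<Xi> \<in> poly_classes. \<Theta> \<sqsubseteq>\<^sub>p \<Xi>}"
proof -
  obtain A :: "'k set" where A: "\<Theta> = poly_class A" "finite A" "A \<noteq> {}"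
    using assms by (auto simp: Sigma_class_def)
  define \<Q> where
    "\<Q> = {Q :: 'k poly. lead_coeff Q = 1 \<and> degree Q < card A \<and> {x. poly Q x = 0} \<subseteq> A}"
  have "{\<Xi> \<in> poly_classes. \<Theta> \<sqsubseteq>\<^sub>p \<Xi>} \<subseteq> insert (poly_class {0}) ((\<lambda>Q. poly_class (poly Q ` A)) ` \<Q>)"
  proof
    fix \<Xi> assume "\<Xi> \<in> {\<Xi> \<in> poly_classes. \<Theta> \<sqsubseteq>\<^sub>p \<Xi>}"
    then obtain B where B: "\<Xi> = poly_class B" and "\<Theta> \<sqsubseteq>\<^sub>p poly_class B"
      by (auto simp: poly_classes_def poly_class_def elim: quotientE)
    then have AB: "A \<le>\<^sub>p B" by (simp add: A(1) class_le_poly_class)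
    show "\<Xi> \<in> insert (poly_class {0}) ((\<lambda>Q. poly_class (poly Q ` A)) ` \<Q>)"
    proof (cases "card B \<ge> 2")
      case True
      then obtain Q where "Q \<in> \<Q>" "poly_class B = poly_class (poly Q ` A)"
        using poly_le_imp_monic_image[OF AB A(2,3)] unfolding \<Q>_def by blast
      then show ?thesis using B by blast
    next
      case False
      obtain P where "B = poly P ` A" using poly_le_finiteE[OF AB A(2,3)] by blast
      then have "card B \<noteq> 0" using A(2,3) by simp
      then have "card B = 1" using False by linarith
      then obtain b where "B = {b}" using card_1_singletonE by blast
      then show ?thesis using B poly_class_singleton by blast
    qed
  qed
  moreover have "finite \<Q>"
    unfolding \<Q>_def using A(2) by (rule finite_monic_polys_roots_subset)
  ultimately show ?thesis using finite_subset by blast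
qed

end
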